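(* Let $p,q\ge 1$, $n=p+q$, and let $G_0=\mathrm{SU}(p,q)\subset \mathrm{SL}(n,\mathbb{C})$. If $\vec{\lambda}\in\mathfrak{a}$ is admissible, then $\exp(\vec{\lambda})\,G_0\subset G_0AN$; that is, for every $g\in G_0$ there exist $g'\in G_0$, $a\in A$ and $u\in N$ such that $\exp(\vec{\lambda})\,g=g'au$.
   Context: Let $p,q$ be positive integers and $n=p+q$. Equip $\mathbb{C}^n$ with the sesquilinear pairing $\langle \mathbf{x},\mathbf{y}\rangle=\sum_{i=1}^p x_i\bar y_i-\sum_{j=p+1}^n x_j\bar y_j$. $G_0=\mathrm{SU}(p,q)$ is the subgroup of $G=\mathrm{SL}(n,\mathbb{C})$ preserving this pairing. $A\subset G$ is the subgroup of diagonal matrices with positive real diagonal entries (and determinant 1), $N\subset G$ is the subgroup of unipotent upper triangular matrices, and $\mathfrak{a}$ is the Lie algebra of $A$ (real diagonal matrices of trace zero). An element $\vec{\lambda}=\mathrm{diag}(\lambda_1,\dots,\lambda_p,\mu_1,\dots,\mu_q)\in\mathfrak{a}$ is called admissible if $\lambda_i>\mu_j$ for all $1\le i\le p$, $1\le j\le q$. *)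

theory Defs
  imports "Jordan_Normal_Form.Determinant"
begin

text \<open>
  Vectors and matrices carry their dimension explicitly and are indexed from 0, so the
  coordinates \<open>1, \<dots>, p\<close> are the indices \<open>{..<p}\<close> and the coordinates
  \<open>p + 1, \<dots>, p + q\<close> are the indices \<open>{p..<p + q}\<close>.
\<close>

definition pairing :: "nat \<Rightarrow> nat \<Rightarrow> complex vec \<Rightarrow> complex vec \<Rightarrow> complex" where
  "pairing p q x y =
     (\<Sum>i<p. x $ i * cnj (y $ i)) - (\<Sum>j=p..<p + q. x $ j * cnj (y $ j))"

definition SL :: "nat \<Rightarrow> complex mat set" where
  "SL n = {g \<in> carrier_mat n n. det g = 1}"

definition SU :: "nat \<Rightarrow> nat \<Rightarrow> complex mat set" where
  "SU p q = {g \<in> SL (p + q).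
     \<forall>x \<in> carrier_vec (p + q). \<forall>y \<in> carrier_vec (p + q).
       pairing p q (g *\<^sub>v x) (g *\<^sub>v y) = pairing p q x y}"

definition A_group :: "nat \<Rightarrow> complex mat set" where
  "A_group n = {a \<in> SL n. diagonal_mat a \<and>
     (\<forall>i<n. a $$ (i, i) \<in> \<real> \<and> Re (a $$ (i, i)) > 0)}"

definition unipotent :: "nat \<Rightarrow> complex mat \<Rightarrow> bool" where
  "unipotent n u \<longleftrightarrow> (\<exists>k. (u - 1\<^sub>m n) ^\<^sub>m k = 0\<^sub>m n n)"

definition N_group :: "nat \<Rightarrow> complex mat set" where
  "N_group n = {u \<in> SL n. upper_triangular u \<and> unipotent n u}"

definition a_algebra :: "nat \<Rightarrow> complex mat set" where
  "a_algebra n = {L \<in> carrier_mat n n. diagonal_mat L \<and>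
     (\<forall>i<n. L $$ (i, i) \<in> \<real>) \<and> (\<Sum>i<n. L $$ (i, i)) = 0}"

text \<open>The entries of a member of \<^const>\<open>a_algebra\<close> are real, so they are compared through
  their real parts.\<close>

definition admissible :: "nat \<Rightarrow> nat \<Rightarrow> complex mat \<Rightarrow> bool" where
  "admissible p q L \<longleftrightarrow>
     (\<forall>i<p. \<forall>j<q. Re (L $$ (i, i)) > Re (L $$ (p + j, p + j)))"

text \<open>The type of matrices of all dimensions is not a normed algebra, so the exponential
  series is summed entrywise.\<close>

definition mat_exp :: "nat \<Rightarrow> complex mat \<Rightarrow> complex mat" where
  "mat_exp n L = mat n n (\<lambda>(i, j). \<Sum>k. (L ^\<^sub>m k) $$ (i, j) / fact k)"

end

theory Submission
  imports Defs
begin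

text \<open>
  Put \<open>D = exp L\<close> and \<open>M = D g\<close>. Gram--Schmidt orthogonalization of the columns of \<open>M\<close> with
  respect to the indefinite pairing, followed by normalization, gives \<open>M = g' a u\<close>, provided that
  the orthogonalized vectors \<open>w\<^sub>1, \<dots>, w\<^sub>n\<close> satisfy \<open>\<langle>w\<^sub>k, w\<^sub>k\<rangle> > 0\<close> for \<open>k \<le> p\<close> and \<open>\<langle>w\<^sub>k, w\<^sub>k\<rangle> < 0\<close>
  for \<open>k > p\<close>. By admissibility there is \<open>c > 0\<close> with \<open>\<langle>D x, D x\<rangle> \<ge> c\<^sup>2 \<langle>x, x\<rangle>\<close> for all \<open>x\<close>.
  If \<open>k \<le> p\<close>, then \<open>w\<^sub>k = M x\<close> with \<open>x\<close> supported on the first \<open>p\<close> coordinates, so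
  \<open>\<langle>w\<^sub>k, w\<^sub>k\<rangle> \<ge> c\<^sup>2 \<langle>g x, g x\<rangle> = c\<^sup>2 \<langle>x, x\<rangle> > 0\<close>. If \<open>k > p\<close>, then \<open>w\<^sub>k\<close> is orthogonal to the first
  \<open>p\<close> columns of \<open>M\<close>; as \<open>D\<close> is self-adjoint for the pairing, \<open>z = g\<^sup>-\<^sup>1 D w\<^sub>k\<close> is orthogonal to the
  first \<open>p\<close> unit vectors, so \<open>c\<^sup>2 \<langle>w\<^sub>k, w\<^sub>k\<rangle> \<le> \<langle>D w\<^sub>k, D w\<^sub>k\<rangle> = \<langle>z, z\<rangle> < 0\<close>.
\<close>

section \<open>Orthogonalization for indefinite Hermitian forms\<close>

context
  fixes h :: "(nat \<Rightarrow> complex) \<Rightarrow> (nat \<Rightarrow> complex) \<Rightarrow> complex"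
begin

text \<open>Gram-Schmidt in coordinates relative to the vectors being orthogonalized, so that
  triangularity becomes a statement about supports. A zero \<open>h (gs_vec i) (gs_vec i)\<close>
  makes the quotient 0 by convention; orthogonality relies on these values being nonzero.\<close>

fun gs_vec :: "nat \<Rightarrow> nat \<Rightarrow> complex" where
  "gs_vec k = (\<lambda>t. (if t = k then 1 else 0) -
     (\<Sum>i<k. h (\<lambda>t. if t = k then 1 else 0) (gs_vec i) / h (gs_vec i) (gs_vec i) * gs_vec i t))"

end

declare gs_vec.simps [simp del]

text \<open>Definiteness is replaced by \<open>nondeg\<close>, which concerns just the vectors the
  process can produce: leading coefficient 1 at \<open>k\<close>, nothing beyond \<open>k\<close>,
  orthogonal to the earlier unit vectors. Orthogonality of \<open>w k\<close> to the earlier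
  \<open>w j\<close> gives orthogonality to the earlier \<open>e j\<close>, hence a nonzero
  \<open>h (w k) (w k)\<close> to divide by at later stages.\<close>

lemma indefinite_gram_schmidt:
  fixes h :: "(nat \<Rightarrow> complex) \<Rightarrow> (nat \<Rightarrow> complex) \<Rightarrow> complex" and n :: nat
  defines "e \<equiv> \<lambda>k t. if t = k then 1 else 0 :: complex"
  assumes lin: "\<And>x c w y k. h (\<lambda>t. x t - (\<Sum>i<k. c i * w i t)) y = h x y - (\<Sum>i<(k::nat). c i * h (w i) y)"
    and herm: "\<And>x y. h y x = cnj (h x y)"
    and nondeg: "\<And>k x. k < n \<Longrightarrow> x k = 1 \<Longrightarrow> (\<And>i. i > k \<Longrightarrow> x i = 0) \<Longrightarrow>
      (\<And>j. j < k \<Longrightarrow> h x (e j) = 0) \<Longrightarrow> h x x \<noteq> 0"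
  obtains w :: "nat \<Rightarrow> nat \<Rightarrow> complex" and c :: "nat \<Rightarrow> nat \<Rightarrow> complex"
  where "\<And>k. w k k = 1" and "\<And>k i. i > k \<Longrightarrow> w k i = 0"
    and "\<And>k. e k = (\<lambda>t. w k t - (\<Sum>i<k. c k i * w i t))"
    and "\<And>j k. k < n \<Longrightarrow> j < k \<Longrightarrow> h (w k) (w j) = 0"
    and "\<And>j k. k < n \<Longrightarrow> j < k \<Longrightarrow> h (w k) (e j) = 0"
proof -
  define w where "w = gs_vec h"
  define c where "c = (\<lambda>k i. h (e k) (w i) / h (w i) (w i))"
  have w: "w k = (\<lambda>t. e k t - (\<Sum>i<k. c k i * w i t))" for k
    unfolding w_def c_def e_def by (subst gs_vec.simps) simp
  have supp: "w k i = 0" if "i > k" for k i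
    using that
  proof (induction k rule: less_induct)
    case (less k)
    then show ?case by (subst w) (simp add: e_def)
  qed
  have diag: "w k k = 1" for k
    by (subst w) (simp add: e_def supp)
  \<comment> \<open>The sign of \<open>c\<close> is absorbed so that this expansion has the shape to
    which \<open>lin\<close> applies.\<close>
  have basis: "e k = (\<lambda>t. w k t - (\<Sum>i<k. (- c k i) * w i t))" for k
    by (rule ext) (subst w, simp add: sum_negf)
  \<comment> \<open>Antilinearity in the second argument is obtained by conjugating
    \<open>lin\<close> through \<open>herm\<close>.\<close>
  have right: "h x (e j) = h x (w j) - (\<Sum>i<j. cnj (- c j i) * h x (w i))" for x j
  proof -
    have "h (e j) x = h (w j) x - (\<Sum>i<j. (- c j i) * h (w i) x)"
      by (subst basis) (rule lin)
    then have "cnj (h (e j) x) = cnj (h (w j) x - (\<Sum>i<j. (- c j i) * h (w i) x))"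
      by simp
    also have "\<dots> = cnj (h (w j) x) - (\<Sum>i<j. cnj (- c j i) * cnj (h (w i) x))"
      by (simp only: complex_cnj_diff cnj_sum complex_cnj_mult)
    finally show ?thesis by (simp only: herm [symmetric])
  qed
  have orth: "h (w k) (w j) = 0 \<and> h (w k) (e j) = 0" if "k < n" "j < k" for j k
    using that
  proof (induction k arbitrary: j rule: less_induct)
    case (less k)
    have nz: "h (w i) (w i) \<noteq> 0" if "i < k" for i
      by (rule nondeg [of i]) (use that less diag supp in auto)
    have orth0: "h (w k) (w j) = 0" if j: "j < k" for j
    proof -
      have "h (w i) (w j) = 0" if "i < k" "i \<noteq> j" for i
      proof (cases "i < j")
        case True
        then have "h (w j) (w i) = 0" using less j by auto
        then show ?thesis by (subst herm) simp
      next
        case False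
        then show ?thesis using less that by auto
      qed
      \<comment> \<open>By induction just the term \<open>i = j\<close> survives, and there
        \<open>nz\<close> cancels the denominator of \<open>c k j\<close>.\<close>
      then have "(\<Sum>i<k. c k i * h (w i) (w j)) = (\<Sum>i<k. if i = j then h (e k) (w j) else 0)"
        by (intro sum.cong) (auto simp: c_def nz)
      then have "(\<Sum>i<k. c k i * h (w i) (w j)) = h (e k) (w j)"
        using j by simp
      then show ?thesis
        by (subst w) (simp add: lin)
    qed
    then show ?case using right [of "w k" j] less.prems by simp
  qed
  show ?thesis
    using that [of w "\<lambda>k i. - c k i", OF diag supp basis] orth by blast
qed

section \<open>Diagonal and triangular matrices\<close>

lemma mat_diag_index: "i < n \<Longrightarrow> j < n \<Longrightarrow> mat_diag n f $$ (i, j) = (if i = j then f j else 0)"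
  by (simp add: mat_diag_def)

lemma mat_diag_pow: "mat_diag n f ^\<^sub>m k = mat_diag n (\<lambda>i. f i ^ k :: 'a :: comm_ring_1)"
proof (induction k)
  case 0
  have "dim_row (mat_diag n f) = n" by (simp add: mat_diag_def)
  then show ?case by simp
next
  case (Suc k)
  then show ?case by (simp add: mult.commute)
qed

lemma det_mat_diag: "det (mat_diag n f) = (\<Prod>i<n. f i :: 'a :: comm_ring_1)"
proof -
  have "det (mat_diag n f) = prod_list (diag_mat (mat_diag n f))"
    by (rule det_upper_triangular [of _ n]) (auto simp: mat_diag_def)
  then show ?thesis
    by (simp add: prod_list_diag_prod mat_diag_def atLeast0LessThan)
qed

lemma mat_exp_mat_diag: "mat_exp n (mat_diag n f) = mat_diag n (\<lambda>i. exp (f i))"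
proof (rule eq_matI)
  fix i j assume "i < dim_row (mat_diag n (\<lambda>i. exp (f i)))" "j < dim_col (mat_diag n (\<lambda>i. exp (f i)))"
  then have ij: "i < n" "j < n" by (auto simp: mat_diag_def)
  have "exp (f j) = (\<Sum>k. f j ^ k / fact k)"
    by (simp add: exp_def scaleR_conv_of_real divide_simps mult.commute)
  from ij this [symmetric] show "mat_exp n (mat_diag n f) $$ (i, j) = mat_diag n (\<lambda>i. exp (f i)) $$ (i, j)"
    by (simp add: mat_exp_def mat_diag_pow mat_diag_index)
qed (auto simp: mat_exp_def mat_diag_def)

text \<open>Each factor \<open>U - 1\<close> moves the support one diagonal further up: the entry
  \<open>(i, j)\<close> of the \<open>k\<close>-th power vanishes for \<open>j < i + k\<close>, so
  the \<open>n\<close>-th power is zero.\<close>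

lemma unipotent_unit_upper_triangular:
  assumes U: "U \<in> carrier_mat n n" and ut: "upper_triangular U"
    and diag: "\<And>i. i < n \<Longrightarrow> U $$ (i, i) = 1"
  shows "unipotent n U"
proof -
  let ?N = "U - 1\<^sub>m n"
  have N: "?N \<in> carrier_mat n n" using U by auto
  have N0: "?N $$ (i, j) = 0" if "i < n" "j < n" "j \<le> i" for i j
    using that U ut diag by (cases "i = j") auto
  have pow: "(?N ^\<^sub>m k) $$ (i, j) = 0" if "i < n" "j < n" "j < i + k" for i j k
    using that
  proof (induction k arbitrary: j)
    case (Suc k)
    have P: "?N ^\<^sub>m k \<in> carrier_mat n n" using N by simp
    have "(?N ^\<^sub>m Suc k) $$ (i, j) = (\<Sum>l<n. (?N ^\<^sub>m k) $$ (i, l) * ?N $$ (l, j))"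
      using Suc.prems U P by (simp add: scalar_prod_def atLeast0LessThan)
    also have "\<dots> = 0"
    proof (rule sum.neutral, rule ballI)
      fix l assume l: "l \<in> {..<n}"
      show "(?N ^\<^sub>m k) $$ (i, l) * ?N $$ (l, j) = 0"
      proof (cases "l < i + k")
        case True
        then show ?thesis using Suc l by auto
      next
        case False
        then show ?thesis using Suc.prems l N0 [of l j] by simp
      qed
    qed
    finally show ?case .
  qed (use U in auto)
  have "?N ^\<^sub>m n = 0\<^sub>m n n"
  proof (rule eq_matI)
    fix i j assume "i < dim_row (0\<^sub>m n n)" "j < dim_col (0\<^sub>m n n)"
    then show "(?N ^\<^sub>m n) $$ (i, j) = 0\<^sub>m n n $$ (i, j)"
      using pow [of i j n] by simp
  qed (use N pow_carrier_mat [OF N, of n] in auto)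
  then show ?thesis unfolding unipotent_def by blast
qed

section \<open>The pairing\<close>

text \<open>The signature of the pairing, and at the same time the sign required of the
  \<open>k\<close>-th orthogonalized vector.\<close>

abbreviation sgn_coeff :: "nat \<Rightarrow> nat \<Rightarrow> complex" where
  "sgn_coeff p i \<equiv> (if i < p then 1 else - 1)"

lemma pairing_alt: "pairing p q x y = (\<Sum>i<p + q. sgn_coeff p i * x $ i * cnj (y $ i))"
proof -
  let ?f = "\<lambda>i. sgn_coeff p i * x $ i * cnj (y $ i)"
  have "sum ?f {..<p + q} = sum ?f {..<p} + sum ?f {p..<p + q}"
    using sum.atLeastLessThan_concat [of 0 p "p + q" ?f] by (simp add: atLeast0LessThan)
  also have "sum ?f {..<p} = (\<Sum>i<p. x $ i * cnj (y $ i))"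
    by (intro sum.cong) auto
  also have "sum ?f {p..<p + q} = (\<Sum>j=p..<p + q. - (x $ j * cnj (y $ j)))"
    by (intro sum.cong) auto
  finally show ?thesis by (simp add: pairing_def sum_negf)
qed

lemma Re_pairing_self:
  "Re (pairing p q x x) = (\<Sum>i<p. (cmod (x $ i))\<^sup>2) - (\<Sum>j=p..<p + q. (cmod (x $ j))\<^sup>2)"
  by (simp add: pairing_def complex_norm_square [symmetric] del: of_real_power)

lemma pairing_cnj: "pairing p q y x = cnj (pairing p q x y)"
  by (simp add: pairing_def mult.commute)

lemma mat_diag_mult_vec:
  fixes f :: "nat \<Rightarrow> 'a :: comm_ring_1"
  assumes "x \<in> carrier_vec n" "i < n"
  shows "(mat_diag n f *\<^sub>v x) $ i = f i * x $ i"
  using assms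
  by (simp add: mat_diag_def scalar_prod_def if_distrib [of "\<lambda>c. c * _"] cong: if_cong)

lemma mult_mat_vec_index:
  assumes "A \<in> carrier_mat n n" "x \<in> carrier_vec n" "i < n"
  shows "(A *\<^sub>v x) $ i = (\<Sum>j<n. A $$ (i, j) * x $ j)"
  using assms by (simp add: scalar_prod_def atLeast0LessThan)

text \<open>Real entries are fixed by conjugation, so a real diagonal matrix is self-adjoint for the
  pairing.\<close>

lemma pairing_mat_diag:
  assumes "x \<in> carrier_vec (p + q)" "y \<in> carrier_vec (p + q)"
  shows "pairing p q (mat_diag (p + q) (\<lambda>i. of_real (d i)) *\<^sub>v x) y =
    pairing p q x (mat_diag (p + q) (\<lambda>i. of_real (d i)) *\<^sub>v y)"
  unfolding pairing_alt
  by (intro sum.cong) (use assms in \<open>auto simp: mat_diag_mult_vec\<close>)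

lemma pairing_unit_vec:
  assumes "x \<in> carrier_vec (p + q)" "j < p + q"
  shows "pairing p q x (unit_vec (p + q) j) = sgn_coeff p j * x $ j"
proof -
  have "pairing p q x (unit_vec (p + q) j) = (\<Sum>i<p + q. if i = j then sgn_coeff p j * x $ j else 0)"
    unfolding pairing_alt using assms by (intro sum.cong) auto
  also have "\<dots> = sgn_coeff p j * x $ j"
    using assms(2) by (subst sum.delta) auto
  finally show ?thesis .
qed

text \<open>The positive part of the form grows by a factor of at least \<open>c\<^sup>2\<close>,
  the negative part by at most \<open>c\<^sup>2\<close>, because \<open>c\<close> separates the two
  blocks of entries.\<close>

lemma pairing_mat_diag_ge:
  assumes x: "x \<in> carrier_vec (p + q)" and "0 \<le> c"
    and ge: "\<And>i. i < p \<Longrightarrow> c \<le> d i"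
    and le: "\<And>j. p \<le> j \<Longrightarrow> j < p + q \<Longrightarrow> 0 \<le> d j \<and> d j \<le> c"
  defines "D \<equiv> mat_diag (p + q) (\<lambda>i. complex_of_real (d i))"
  shows "c\<^sup>2 * Re (pairing p q x x) \<le> Re (pairing p q (D *\<^sub>v x) (D *\<^sub>v x))"
proof -
  have "(\<Sum>i<p. c\<^sup>2 * (cmod (x $ i))\<^sup>2) \<le> (\<Sum>i<p. (cmod ((D *\<^sub>v x) $ i))\<^sup>2)"
    using assms by (intro sum_mono)
      (auto simp: D_def mat_diag_mult_vec norm_mult power_mult_distrib power_mono intro!: mult_right_mono)
  moreover have "(\<Sum>i=p..<p + q. (cmod ((D *\<^sub>v x) $ i))\<^sup>2) \<le> (\<Sum>i=p..<p + q. c\<^sup>2 * (cmod (x $ i))\<^sup>2)"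
    using assms by (intro sum_mono)
      (auto simp: D_def mat_diag_mult_vec norm_mult power_mult_distrib power_mono intro!: mult_right_mono)
  ultimately show ?thesis
    by (simp add: Re_pairing_self sum_distrib_left right_diff_distrib)
qed

lemma vec_nonzero_obtain:
  assumes "x \<in> carrier_vec n" "x \<noteq> 0\<^sub>v n"
  obtains i where "i < n" "x $ i \<noteq> 0"
  using assms by (metis carrier_vecD eq_vecI index_zero_vec)

lemma Re_pairing_pos:
  assumes x: "x \<in> carrier_vec (p + q)" "x \<noteq> 0\<^sub>v (p + q)"
    and "\<And>i. p \<le> i \<Longrightarrow> i < p + q \<Longrightarrow> x $ i = 0"
  shows "0 < Re (pairing p q x x)"
proof -
  obtain i where "i < p + q" "x $ i \<noteq> 0" using vec_nonzero_obtain [OF x] .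
  then have "0 < (\<Sum>i<p. (cmod (x $ i))\<^sup>2)"
    using assms(3) [of i] by (intro sum_pos2 [of _ i]) (auto simp: not_le [symmetric])
  then show ?thesis by (simp add: Re_pairing_self assms(3))
qed

lemma Re_pairing_neg:
  assumes x: "x \<in> carrier_vec (p + q)" "x \<noteq> 0\<^sub>v (p + q)"
    and "\<And>i. i < p \<Longrightarrow> x $ i = 0"
  shows "Re (pairing p q x x) < 0"
proof -
  obtain i where "i < p + q" "x $ i \<noteq> 0" using vec_nonzero_obtain [OF x] .
  then have "0 < (\<Sum>j=p..<p + q. (cmod (x $ j))\<^sup>2)"
    using assms(3) [of i] by (intro sum_pos2 [of _ i]) (auto simp: not_le [symmetric])
  then show ?thesis by (simp add: Re_pairing_self assms(3))
qed

section \<open>Matrices with pseudo-orthonormal columns\<close>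

lemma pairing_columns:
  assumes F: "F \<in> carrier_mat (p + q) (p + q)"
    and orth: "\<And>i j. i < p + q \<Longrightarrow> j < p + q \<Longrightarrow>
      pairing p q (col F i) (col F j) = (if i = j then sgn_coeff p i else 0)"
    and x: "x \<in> carrier_vec (p + q)" and y: "y \<in> carrier_vec (p + q)"
  shows "pairing p q (F *\<^sub>v x) (F *\<^sub>v y) = pairing p q x y"
proof -
  let ?n = "p + q"
  \<comment> \<open>Once the sum over \<open>t\<close> is moved innermost, the value depends on
    \<open>F\<close> through the Gram matrix of its columns alone, which is that of the unit
    vectors.\<close>
  have "pairing p q (F *\<^sub>v x) (F *\<^sub>v y) = (\<Sum>t<?n. \<Sum>i<?n. \<Sum>j<?n.
      x $ i * cnj (y $ j) * (sgn_coeff p t * F $$ (t, i) * cnj (F $$ (t, j))))"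
    unfolding pairing_alt
  proof (intro sum.cong refl)
    fix t assume "t \<in> {..<?n}"
    then have t: "t < ?n" by simp
    have "sgn_coeff p t * (F *\<^sub>v x) $ t * cnj ((F *\<^sub>v y) $ t) =
      (\<Sum>i<?n. \<Sum>j<?n. sgn_coeff p t * ((F $$ (t, i) * x $ i) * cnj (F $$ (t, j) * y $ j)))"
      unfolding mult_mat_vec_index [OF F x t] mult_mat_vec_index [OF F y t] cnj_sum
        mult.assoc [of "sgn_coeff p t"] sum_product
      by (simp only: sum_distrib_left)
    then show "sgn_coeff p t * (F *\<^sub>v x) $ t * cnj ((F *\<^sub>v y) $ t) = (\<Sum>i<?n. \<Sum>j<?n.
      x $ i * cnj (y $ j) * (sgn_coeff p t * F $$ (t, i) * cnj (F $$ (t, j))))"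
      by (simp only: complex_cnj_mult mult_ac)
  qed
  also have "\<dots> = (\<Sum>i<?n. \<Sum>t<?n. \<Sum>j<?n.
      x $ i * cnj (y $ j) * (sgn_coeff p t * F $$ (t, i) * cnj (F $$ (t, j))))"
    by (rule sum.swap)
  also have "\<dots> = (\<Sum>i<?n. \<Sum>j<?n. \<Sum>t<?n.
      x $ i * cnj (y $ j) * (sgn_coeff p t * F $$ (t, i) * cnj (F $$ (t, j))))"
    by (rule sum.cong [OF refl], rule sum.swap)
  also have "\<dots> = (\<Sum>i<?n. \<Sum>j<?n. x $ i * cnj (y $ j) * pairing p q (col F i) (col F j))"
    using F by (intro sum.cong refl) (simp add: pairing_alt sum_distrib_left)
  also have "\<dots> = (\<Sum>i<?n. \<Sum>j<?n. if i = j then sgn_coeff p i * x $ i * cnj (y $ i) else 0)"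
    by (intro sum.cong refl) (simp add: orth)
  also have "\<dots> = pairing p q x y"
    unfolding pairing_alt by (intro sum.cong refl) (simp add: sum.delta')
  finally show ?thesis .
qed

text \<open>With \<open>S\<close> the diagonal matrix of signs, the hypothesis reads
  \<open>F^T S cnj(F) = S\<close>; determinants give \<open>|det F|^2 = 1\<close>. The phase of
  \<open>det F\<close> remains open here.\<close>

lemma norm_det_pairing_columns:
  assumes F: "F \<in> carrier_mat (p + q) (p + q)"
    and orth: "\<And>i j. i < p + q \<Longrightarrow> j < p + q \<Longrightarrow>
      pairing p q (col F i) (col F j) = (if i = j then sgn_coeff p i else 0)"
  shows "cmod (det F) = 1"
proof -
  let ?n = "p + q"
  interpret cnj: comm_ring_hom cnj by unfold_locales auto
  define S where "S = mat_diag ?n (sgn_coeff p)"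
  have S: "S \<in> carrier_mat ?n ?n" by (simp add: S_def)
  have C: "map_mat cnj F \<in> carrier_mat ?n ?n" using F by simp
  have SC: "S * map_mat cnj F \<in> carrier_mat ?n ?n" using S C by simp
  have "transpose_mat F * (S * map_mat cnj F) = S"
  proof (rule eq_matI)
    fix i j assume "i < dim_row S" "j < dim_col S"
    then have ij: "i < ?n" "j < ?n" using S by auto
    have "(transpose_mat F * (S * map_mat cnj F)) $$ (i, j) = pairing p q (col F i) (col F j)"
      unfolding S_def mat_diag_mult_left [OF C] pairing_alt using ij F
      by (simp add: scalar_prod_def atLeast0LessThan) (intro sum.cong, auto)
    with ij show "(transpose_mat F * (S * map_mat cnj F)) $$ (i, j) = S $$ (i, j)"
      by (simp add: orth S_def mat_diag_index)
  qed (use F S in auto)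
  then have "det F * (det S * cnj (det F)) = det S"
    using det_mult [OF _ SC, of "transpose_mat F"] det_mult [OF S C] det_transpose [OF F] F by simp
  moreover have "det S \<noteq> 0"
    by (simp add: S_def det_mat_diag)
  ultimately have "det F * cnj (det F) = 1"
    by (simp add: mult.left_commute)
  then have "(cmod (det F))\<^sup>2 = 1"
    by (metis complex_norm_square of_real_eq_1_iff)
  then show ?thesis
    by (simp add: power2_eq_1_iff)
       (metis norm_ge_zero not_one_le_zero neg_0_le_iff_le)
qed

section \<open>The decomposition\<close>

text \<open>Gram-Schmidt for the pairing pulled back along \<open>M\<close>, where the columns of
  \<open>M\<close> become the unit vectors. As the signs in \<open>sgn\<close> occur in the order of
  the signature, the normalized vectors form an isometry without reordering, and the change of basis
  stays triangular.\<close>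

lemma SU_A_N_decomposition:
  assumes M: "M \<in> carrier_mat (p + q) (p + q)" and detM: "det M = 1"
    and sgn: "\<And>k x. k < p + q \<Longrightarrow> x \<in> carrier_vec (p + q) \<Longrightarrow> x $ k = 1 \<Longrightarrow>
      (\<And>i. k < i \<Longrightarrow> i < p + q \<Longrightarrow> x $ i = 0) \<Longrightarrow>
      (\<And>j. j < k \<Longrightarrow> pairing p q (M *\<^sub>v x) (M *\<^sub>v unit_vec (p + q) j) = 0) \<Longrightarrow>
      0 < Re (sgn_coeff p k * pairing p q (M *\<^sub>v x) (M *\<^sub>v x))"
  obtains g a u where "g \<in> SU p q" "a \<in> A_group (p + q)" "u \<in> N_group (p + q)" "M = g * a * u"
proof -
  let ?n = "p + q"
  define h where "h = (\<lambda>x y. pairing p q (M *\<^sub>v vec ?n x) (M *\<^sub>v vec ?n y))"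
  have lin0: "(M *\<^sub>v vec ?n (\<lambda>t. x t - (\<Sum>i<k. c i * w i t))) $ t =
      (M *\<^sub>v vec ?n x) $ t - (\<Sum>i<k. c i * (M *\<^sub>v vec ?n (w i)) $ t)"
    if "t < ?n" for x c w t and k :: nat
  proof -
    have "(\<Sum>j<?n. \<Sum>i<k. M $$ (t, j) * (c i * w i j)) = (\<Sum>i<k. \<Sum>j<?n. M $$ (t, j) * (c i * w i j))"
      by (rule sum.swap)
    with that show ?thesis
      by (simp add: mult_mat_vec_index [OF M] right_diff_distrib sum_subtractf sum_distrib_left mult.left_commute
        del: index_mult_mat_vec)
  qed
  have lin: "h (\<lambda>t. x t - (\<Sum>i<k. c i * w i t)) y = h x y - (\<Sum>i<k. c i * h (w i) y)"
    for x c w y and k :: nat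
  proof -
    let ?Y = "M *\<^sub>v vec ?n y"
    have "h (\<lambda>t. x t - (\<Sum>i<k. c i * w i t)) y =
      (\<Sum>t<?n. sgn_coeff p t * ((M *\<^sub>v vec ?n x) $ t - (\<Sum>i<k. c i * (M *\<^sub>v vec ?n (w i)) $ t)) * cnj (?Y $ t))"
      unfolding h_def pairing_alt by (intro sum.cong refl) (simp only: lin0 lessThan_iff)
    also have "\<dots> = h x y - (\<Sum>t<?n. \<Sum>i<k. c i * (sgn_coeff p t * (M *\<^sub>v vec ?n (w i)) $ t * cnj (?Y $ t)))"
      unfolding h_def pairing_alt sum_subtractf [symmetric]
      by (intro sum.cong refl)
        (simp only: right_diff_distrib left_diff_distrib sum_distrib_left sum_distrib_right mult_ac)
    also have "\<dots> = h x y - (\<Sum>i<k. c i * h (w i) y)"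
      unfolding h_def pairing_alt sum_distrib_left by (subst sum.swap) (rule refl)
    finally show ?thesis .
  qed
  have herm: "h y x = cnj (h x y)" for x y
    unfolding h_def by (rule pairing_cnj)
  have unit: "vec ?n (\<lambda>t. if t = j then 1 else 0) = unit_vec ?n j" for j
    by (rule eq_vecI) (auto simp: unit_vec_def)
  have sgn_h: "0 < Re (sgn_coeff p k * h x x)"
    if "k < ?n" "x k = 1" "\<And>i. i > k \<Longrightarrow> x i = 0"
      "\<And>j. j < k \<Longrightarrow> h x (\<lambda>t. if t = j then 1 else 0) = 0" for k x
    unfolding h_def by (rule sgn) (use that in \<open>auto simp: h_def unit\<close>)
  obtain w c where diag: "\<And>k. w k k = 1" and supp: "\<And>k i. i > k \<Longrightarrow> w k i = 0"
    and basis: "\<And>k. (\<lambda>t. if t = k then 1 else 0) = (\<lambda>t. w k t - (\<Sum>i<k. c k i * w i t))"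
    and orth: "\<And>j k. k < ?n \<Longrightarrow> j < k \<Longrightarrow> h (w k) (w j) = 0"
    and orth_unit: "\<And>j k. k < ?n \<Longrightarrow> j < k \<Longrightarrow> h (w k) (\<lambda>t. if t = j then 1 else 0) = 0"
  proof (rule indefinite_gram_schmidt [of h ?n])
    fix k x assume "k < ?n" "x k = 1" "\<And>i. i > k \<Longrightarrow> x i = 0"
      "\<And>j. j < k \<Longrightarrow> h x (\<lambda>t. if t = j then 1 else 0) = 0"
    then have "0 < Re (sgn_coeff p k * h x x)" by (rule sgn_h)
    then show "h x x \<noteq> 0" by auto
  qed (use lin herm in blast)+
  have pos: "0 < Re (sgn_coeff p k * h (w k) (w k))" if "k < ?n" for k
    by (rule sgn_h) (use that diag supp orth_unit in auto)
  \<comment> \<open>The pseudo-length of the \<open>k\<close>-th vector: the sign factor makes the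
    radicand positive by \<open>pos\<close>.\<close>
  define \<rho> where "\<rho> k = sqrt (Re (sgn_coeff p k * h (w k) (w k)))" for k
  have \<rho>: "\<rho> k > 0" if "k < ?n" for k using pos [OF that] by (simp add: \<rho>_def)
  have \<rho>2: "h (w k) (w k) = sgn_coeff p k * of_real (\<rho> k * \<rho> k)" if "k < ?n" for k
  proof -
    have "Im (h (w k) (w k)) = 0" using herm [of "w k" "w k"] by (simp add: complex_eq_iff)
    with pos [OF that] show ?thesis by (auto simp: \<rho>_def complex_eq_iff split: if_splits)
  qed
  have orth': "h (w i) (w j) = 0" if "i < ?n" "j < ?n" "i \<noteq> j" for i j
    using that orth [of i j] orth [of j i] herm [of "w i" "w j"] by (cases "j < i") auto
  \<comment> \<open>\<open>F\<close> has the normalized vectors as columns, \<open>a\<close>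
    restores their lengths, and column \<open>k\<close> of \<open>u\<close> holds the coefficients
    of \<open>basis\<close>, which write the \<open>k\<close>-th column of \<open>M\<close> in terms
    of the orthogonalized vectors.\<close>
  define F where "F = mat ?n ?n (\<lambda>(t, k). (M *\<^sub>v vec ?n (w k)) $ t / of_real (\<rho> k))"
  define a where "a = mat_diag ?n (\<lambda>k. complex_of_real (\<rho> k))"
  define u where "u = mat ?n ?n (\<lambda>(i, k). if i < k then - c k i else if i = k then 1 else 0)"
  have F: "F \<in> carrier_mat ?n ?n" and a: "a \<in> carrier_mat ?n ?n" and u: "u \<in> carrier_mat ?n ?n"
    by (simp_all add: F_def a_def u_def)
  have colF: "pairing p q (col F i) (col F j) = (if i = j then sgn_coeff p i else 0)"
    if "i < ?n" "j < ?n" for i j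
  proof -
    have "pairing p q (col F i) (col F j) = h (w i) (w j) / of_real (\<rho> i * \<rho> j)"
      using that M unfolding h_def pairing_alt sum_divide_distrib
      by (intro sum.cong refl) (simp add: F_def del: index_mult_mat_vec)
    then show ?thesis
      using \<rho>2 [OF that(1)] \<rho> [OF that(1)] orth' [OF that] by auto
  qed
  have FaX: "F * a = mat ?n ?n (\<lambda>(t, k). (M *\<^sub>v vec ?n (w k)) $ t)"
    unfolding a_def mat_diag_mult_right [OF F]
    by (rule eq_matI) (use \<rho> in \<open>auto simp: F_def less_imp_neq [symmetric] simp del: index_mult_mat_vec\<close>)
  have eq: "F * a * u = M"
  proof (rule eq_matI)
    fix t k assume "t < dim_row M" "k < dim_col M"
    then have tk: "t < ?n" "k < ?n" using M by auto
    let ?v = "\<lambda>i. (M *\<^sub>v vec ?n (w i)) $ t"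
    have "(F * a * u) $$ (t, k) = (\<Sum>i<?n. ?v i * u $$ (i, k))"
      unfolding FaX using tk u by (simp add: scalar_prod_def atLeast0LessThan del: index_mult_mat_vec)
    also have "\<dots> = (\<Sum>i<Suc k. ?v i * u $$ (i, k))"
      using tk by (intro sum.mono_neutral_right) (auto simp: u_def)
    also have "\<dots> = ?v k + (\<Sum>i<k. ?v i * (- c k i))"
      using tk by (simp add: u_def del: index_mult_mat_vec)
    also have "\<dots> = ?v k - (\<Sum>i<k. c k i * ?v i)"
      by (simp add: sum_negf mult.commute del: index_mult_mat_vec)
    also have "\<dots> = (M *\<^sub>v vec ?n (\<lambda>t. w k t - (\<Sum>i<k. c k i * w i t))) $ t"
      by (rule lin0 [OF tk(1), symmetric])
    also have "\<dots> = (M *\<^sub>v unit_vec ?n k) $ t"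
      by (simp only: basis [symmetric] unit)
    also have "\<dots> = M $$ (t, k)"
      using M tk by simp
    finally show "(F * a * u) $$ (t, k) = M $$ (t, k)" .
  qed (use F a u M in auto)
  have utu: "upper_triangular u" by (auto simp: u_def)
  have "det u = prod_list (diag_mat u)"
    by (rule det_upper_triangular [OF utu u])
  then have detu: "det u = 1"
    by (simp add: prod_list_diag_prod u_def)
  \<comment> \<open>Since \<open>det F * r = 1\<close> with \<open>r > 0\<close> and
    \<open>|det F| = 1\<close>, both determinants are 1; this fixes the phase of
    \<open>det F\<close>.\<close>
  define r where "r = (\<Prod>k<?n. \<rho> k)"
  have r: "r > 0" unfolding r_def by (rule prod_pos) (use \<rho> in auto)
  have deta: "det a = of_real r" by (simp add: a_def det_mat_diag r_def)
  have "det F * of_real r = 1"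
    using det_mult [of "F * a" ?n u] det_mult [OF F a] F a u eq detM detu deta by simp
  moreover from this have "cmod (det F) * r = 1"
    using r by (metis abs_of_pos norm_mult norm_of_real norm_one)
  ultimately have "r = 1" "det F = 1"
    using norm_det_pairing_columns [OF F colF] by auto
  then have "F \<in> SU p q"
    using F pairing_columns [OF F colF] by (auto simp: SU_def SL_def)
  moreover have "a \<in> A_group ?n"
    using a deta \<open>r = 1\<close> \<rho> by (auto simp: A_group_def SL_def diagonal_mat_def a_def mat_diag_def)
  moreover have "u \<in> N_group ?n"
    using u detu utu unipotent_unit_upper_triangular [OF u utu]
    by (auto simp: N_group_def SL_def u_def)
  ultimately show ?thesis using that eq by blast
qed

section \<open>Signs for a positive diagonal matrix times an element of SU(p,q)\<close>

lemma mat_diag_mult_SU_sgn: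
  assumes g: "g \<in> SU p q" and c: "0 < c"
    and ge: "\<And>i. i < p \<Longrightarrow> c \<le> d i"
    and le: "\<And>j. p \<le> j \<Longrightarrow> j < p + q \<Longrightarrow> 0 < d j \<and> d j \<le> c"
    and x: "x \<in> carrier_vec (p + q)" "x \<noteq> 0\<^sub>v (p + q)"
  defines "M \<equiv> mat_diag (p + q) (\<lambda>i. complex_of_real (d i)) * g"
  shows "(\<And>i. p \<le> i \<Longrightarrow> i < p + q \<Longrightarrow> x $ i = 0) \<Longrightarrow>
      0 < Re (pairing p q (M *\<^sub>v x) (M *\<^sub>v x))"
    and "(\<And>j. j < p \<Longrightarrow> pairing p q (M *\<^sub>v x) (M *\<^sub>v unit_vec (p + q) j) = 0) \<Longrightarrow>
      Re (pairing p q (M *\<^sub>v x) (M *\<^sub>v x)) < 0"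
proof -
  let ?n = "p + q"
  define D where "D = mat_diag ?n (\<lambda>i. complex_of_real (d i))"
  have D: "D \<in> carrier_mat ?n ?n" by (simp add: D_def)
  have g': "g \<in> carrier_mat ?n ?n" "det g = 1"
    and iso: "\<And>y z. y \<in> carrier_vec ?n \<Longrightarrow> z \<in> carrier_vec ?n \<Longrightarrow>
      pairing p q (g *\<^sub>v y) (g *\<^sub>v z) = pairing p q y z"
    using g by (auto simp: SU_def SL_def)
  have Mv: "M *\<^sub>v y = D *\<^sub>v (g *\<^sub>v y)" if "y \<in> carrier_vec ?n" for y
    unfolding M_def D_def [symmetric] using D g' that by simp
  have ge': "c\<^sup>2 * Re (pairing p q y y) \<le> Re (pairing p q (D *\<^sub>v y) (D *\<^sub>v y))"
    if "y \<in> carrier_vec ?n" for y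
    unfolding D_def using that c ge le by (intro pairing_mat_diag_ge) (auto simp: less_imp_le)
  {
    assume *: "\<And>i. p \<le> i \<Longrightarrow> i < p + q \<Longrightarrow> x $ i = 0"
    have "0 < c\<^sup>2 * Re (pairing p q x x)"
      using c Re_pairing_pos [OF x *] by simp
    also have "\<dots> = c\<^sup>2 * Re (pairing p q (g *\<^sub>v x) (g *\<^sub>v x))"
      by (simp add: iso x)
    also have "\<dots> \<le> Re (pairing p q (M *\<^sub>v x) (M *\<^sub>v x))"
      unfolding Mv [OF x(1)] using g' x by (intro ge') auto
    finally show "0 < Re (pairing p q (M *\<^sub>v x) (M *\<^sub>v x))" .
  next
    assume *: "\<And>j. j < p \<Longrightarrow> pairing p q (M *\<^sub>v x) (M *\<^sub>v unit_vec (p + q) j) = 0"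
    define v where "v = M *\<^sub>v x"
    have v: "v \<in> carrier_vec ?n" using D g' x by (simp add: v_def Mv)
    have Dv: "D *\<^sub>v v \<in> carrier_vec ?n" using D v by simp
    have d0: "d i \<noteq> 0" if "i < ?n" for i
      using that c ge [of i] le [of i] by (cases "i < p") force+
    \<comment> \<open>As \<open>det g = 1\<close>, the adjugate is the inverse of \<open>g\<close>,
      so \<open>g z = D v\<close>.\<close>
    define z where "z = adj_mat g *\<^sub>v (D *\<^sub>v v)"
    have z: "z \<in> carrier_vec ?n"
      unfolding z_def using adj_mat(1) [OF g'(1)] Dv by (rule mult_mat_vec_carrier)
    have "(1 :: complex) \<cdot>\<^sub>m 1\<^sub>m ?n = 1\<^sub>m ?n" by (rule eq_matI) auto
    then have "g * adj_mat g = 1\<^sub>m ?n" using adj_mat(2) [OF g'(1)] g'(2) by simp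
    then have gz: "g *\<^sub>v z = D *\<^sub>v v"
      unfolding z_def using assoc_mult_mat_vec [OF g'(1) adj_mat(1) [OF g'(1)] Dv] Dv by simp
    \<comment> \<open>Invariance under \<open>g\<close> and self-adjointness of \<open>D\<close>
      turn the coordinate \<open>z $ j\<close> into the pairing of \<open>v\<close> with the
      \<open>j\<close>-th column of \<open>M\<close>.\<close>
    have z0: "z $ j = 0" if "j < p" for j
    proof -
      have e: "unit_vec ?n j \<in> carrier_vec ?n" by simp
      have "z $ j = pairing p q z (unit_vec ?n j)"
        using that by (simp add: pairing_unit_vec [OF z])
      also have "\<dots> = pairing p q (D *\<^sub>v v) (g *\<^sub>v unit_vec ?n j)"
        using iso [OF z e] by (simp add: gz)
      also have "\<dots> = pairing p q v (D *\<^sub>v (g *\<^sub>v unit_vec ?n j))"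
        unfolding D_def by (rule pairing_mat_diag) (use v g' in auto)
      also have "\<dots> = 0"
        using * [OF that] Mv [OF e] by (simp add: v_def)
      finally show ?thesis .
    qed
    \<comment> \<open>Otherwise \<open>D D g x = 0\<close>; the diagonal entries of \<open>D\<close>
      are nonzero and \<open>g\<close> is invertible, which forces \<open>x = 0\<close>.\<close>
    have "z \<noteq> 0\<^sub>v ?n"
    proof
      assume "z = 0\<^sub>v ?n"
      moreover have "g *\<^sub>v 0\<^sub>v ?n = 0\<^sub>v ?n"
        by (rule eq_vecI) (use g' in auto)
      ultimately have DDgx: "D *\<^sub>v (D *\<^sub>v (g *\<^sub>v x)) = 0\<^sub>v ?n"
        using gz x by (simp add: v_def Mv)
      have "g *\<^sub>v x = 0\<^sub>v ?n"
      proof (rule eq_vecI)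
        fix i assume "i < dim_vec (0\<^sub>v ?n)"
        then have i: "i < ?n" by simp
        have gx: "g *\<^sub>v x \<in> carrier_vec ?n" using g' x by simp
        then have "D *\<^sub>v (g *\<^sub>v x) \<in> carrier_vec ?n" using D by simp
        then have "(D *\<^sub>v (D *\<^sub>v (g *\<^sub>v x))) $ i = of_real (d i) * (of_real (d i) * (g *\<^sub>v x) $ i)"
          unfolding D_def using i gx by (simp only: mat_diag_mult_vec)
        then show "(g *\<^sub>v x) $ i = 0\<^sub>v ?n $ i"
          using DDgx d0 [OF i] i by simp
      qed (use g' in auto)
      then show False
        using det_0_iff_vec_prod_zero_field [OF g'(1)] g'(2) x by auto
    qed
    then have "Re (pairing p q z z) < 0"
      using z z0 by (intro Re_pairing_neg) auto
    also have "pairing p q z z = pairing p q (D *\<^sub>v v) (D *\<^sub>v v)"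
      using iso [OF z z] by (simp add: gz)
    finally have "c\<^sup>2 * Re (pairing p q v v) < 0"
      using ge' [OF v] by simp
    then show "Re (pairing p q (M *\<^sub>v x) (M *\<^sub>v x)) < 0"
      using c by (simp add: v_def mult_less_0_iff)
  }
qed

section \<open>Passage from admissibility to the sign conditions\<close>

theorem proposition4p2:
  fixes p q :: nat and L :: "complex mat"
  assumes "p \<ge> 1" and "q \<ge> 1"
    and "L \<in> a_algebra (p + q)"
    and "admissible p q L"
  shows "{mat_exp (p + q) L * g | g. g \<in> SU p q}
    \<subseteq> {g' * a * u | g' a u. g' \<in> SU p q \<and> a \<in> A_group (p + q) \<and> u \<in> N_group (p + q)}"
proof -
  let ?n = "p + q"
  define l where "l i = Re (L $$ (i, i))" for i
  define d where "d i = exp (l i)" for i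
  have L: "L = mat_diag ?n (\<lambda>i. of_real (l i))"
    using assms(3) by (intro eq_matI) (auto simp: a_algebra_def diagonal_mat_def mat_diag_def l_def)
  have D: "mat_exp ?n L = mat_diag ?n (\<lambda>i. of_real (d i))"
    by (subst L) (simp add: mat_exp_mat_diag d_def exp_of_real)
  \<comment> \<open>Trace zero becomes determinant one under the exponential.\<close>
  have "(\<Sum>i<?n. L $$ (i, i)) = 0"
    using assms(3) by (simp add: a_algebra_def)
  from arg_cong [OF this, of Re] have "(\<Sum>i<?n. l i) = 0"
    by (simp add: l_def)
  then have detD: "det (mat_exp ?n L) = 1"
    by (simp add: D det_mat_diag d_def exp_sum [symmetric] of_real_prod [symmetric] del: of_real_prod)
  \<comment> \<open>The least of the first \<open>p\<close> entries, which exists as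
    \<open>p \<ge> 1\<close>. It is attained at some \<open>m\<close>, and admissibility at
    \<open>m\<close> bounds the last \<open>q\<close> entries by \<open>c\<close>.\<close>
  define c where "c = Min (d ` {..<p})"
  have "c \<in> d ` {..<p}"
    unfolding c_def using assms(1) by (intro Min_in) (auto simp: lessThan_empty_iff)
  then obtain m where m: "m < p" "c = d m" by auto
  have c: "c > 0" using m by (simp add: d_def)
  have ge: "c \<le> d i" if "i < p" for i
    unfolding c_def using that by (intro Min_le) auto
  have le: "0 < d j \<and> d j \<le> c" if "p \<le> j" "j < ?n" for j
  proof -
    have "l m > l (p + (j - p))"
      using assms(4) [unfolded admissible_def, rule_format, OF m(1), of "j - p"] that
      by (simp add: l_def)
    then show ?thesis using that by (simp add: d_def m(2))
  qed
  show ?thesis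
  proof safe
    fix g assume g: "g \<in> SU p q"
    define M where "M = mat_exp ?n L * g"
    have g': "g \<in> carrier_mat ?n ?n" "det g = 1"
      using g by (auto simp: SU_def SL_def)
    have E: "mat_exp ?n L \<in> carrier_mat ?n ?n" by (simp add: D)
    have M: "M \<in> carrier_mat ?n ?n" using E g' by (simp add: M_def)
    have detM: "det M = 1" using det_mult [OF E g'(1)] g' detD by (simp add: M_def)
    \<comment> \<open>For \<open>k < p\<close> the support condition kills all coordinates from
      \<open>p\<close> on; for \<open>k \<ge> p\<close> the orthogonality covers all of the first
      \<open>p\<close> columns. These are the two cases of
      \<open>mat_diag_mult_SU_sgn\<close>.\<close>
    have sgn: "0 < Re (sgn_coeff p k * pairing p q (M *\<^sub>v x) (M *\<^sub>v x))"
      if k: "k < ?n" and x: "x \<in> carrier_vec ?n" "x $ k = 1"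
        and supp: "\<And>i. k < i \<Longrightarrow> i < ?n \<Longrightarrow> x $ i = 0"
        and orth: "\<And>j. j < k \<Longrightarrow> pairing p q (M *\<^sub>v x) (M *\<^sub>v unit_vec ?n j) = 0" for k x
    proof -
      have nz: "x \<noteq> 0\<^sub>v ?n" using k x by auto
      show ?thesis
      proof (cases "k < p")
        case True
        then have "0 < Re (pairing p q (M *\<^sub>v x) (M *\<^sub>v x))"
          unfolding M_def D
          by (intro mat_diag_mult_SU_sgn(1) [OF g c]) (use True ge le x(1) nz supp in auto)
        with True show ?thesis by simp
      next
        case False
        then have "Re (pairing p q (M *\<^sub>v x) (M *\<^sub>v x)) < 0"
          unfolding M_def D
          by (intro mat_diag_mult_SU_sgn(2) [OF g c])
            (use False ge le x(1) nz orth [unfolded M_def D] in auto)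
        with False show ?thesis by simp
      qed
    qed
    obtain g1 a u where "g1 \<in> SU p q" "a \<in> A_group ?n" "u \<in> N_group ?n" "M = g1 * a * u"
      using SU_A_N_decomposition [OF M detM sgn] by blast
    then show "\<exists>g' a u. mat_exp ?n L * g = g' * a * u \<and>
        g' \<in> SU p q \<and> a \<in> A_group ?n \<and> u \<in> N_group ?n"
      unfolding M_def by blast
  qed
qed

end
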